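(* Let $G$ be a finite simple graph with $|G|\geq 3$ vertices. Suppose that $G$ is representable with some set $S_0$ of the form $S_0=\{p\}$, where $p$ is a prime larger than twice the number of edges of $G$. Then $G$ is infinitely representable with every finite non-empty set $S$ of primes.
   Context: For a finite non-empty set $S$ of primes, $\mathbb{Z}_S$ is the ring of those rationals whose denominators (in lowest terms) are not divisible by primes outside $S$, and $\mathbb{Z}_S^*$ is its multiplicative group of invertible elements ($S$-units). For a subset $A$ of $\mathbb{Z}_S$, $\mathcal{G}_S(A)$ is the graph with vertex set $A$ in which two vertices $a,b\in A$ are joined by an edge if and only if $a-b\in\mathbb{Z}_S^*$. Ordered subsets $A$ and $A'$ of $\mathbb{Z}_S$ are $S$-equivalent if $A'=uA+b$ for some $u\in\mathbb{Z}_S^*$ and $b\in\mathbb{Z}_S$. A finite graph $G$ is representable with $S$ if $G$ is isomorphic to $\mathcal{G}_S(A)$ for some finite $A\subseteq\mathbb{Z}_S$, and infinitely representable with $S$ if this holds for infinitely many pairwise non-$S$-equivalent $A$. *)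

theory Defs
  imports Complex_Main "HOL-Computational_Algebra.Primes"
begin

record 'v ugraph =
  verts :: "'v set"
  edges :: "'v set set"

definition finite_simple_graph :: "'v ugraph \<Rightarrow> bool" where
  "finite_simple_graph G \<longleftrightarrow>
     finite (verts G) \<and> (\<forall>e\<in>edges G. e \<subseteq> verts G \<and> card e = 2)"

definition graph_isomorphic :: "'v ugraph \<Rightarrow> 'w ugraph \<Rightarrow> bool" where
  "graph_isomorphic G H \<longleftrightarrow>
     (\<exists>f. bij_betw f (verts G) (verts H) \<and>
          (\<forall>x\<in>verts G. \<forall>y\<in>verts G. {x, y} \<in> edges G \<longleftrightarrow> {f x, f y} \<in> edges H))"

text \<open>\<^const>\<open>quotient_of\<close> returns the numerator and the positive denominator of a rational in
  lowest terms.\<close>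

definition S_integers :: "nat set \<Rightarrow> rat set" where
  "S_integers S = {x. \<forall>p. prime p \<and> int p dvd snd (quotient_of x) \<longrightarrow> p \<in> S}"

definition S_units :: "nat set \<Rightarrow> rat set" where
  "S_units S = {u \<in> S_integers S. \<exists>v\<in>S_integers S. u * v = 1}"

text \<open>No loops arise below, since \<open>a - a = 0\<close> is not an S-unit.\<close>

definition S_unit_graph :: "nat set \<Rightarrow> rat set \<Rightarrow> rat ugraph" where
  "S_unit_graph S A =
     \<lparr>verts = A, edges = {{a, b} | a b. a \<in> A \<and> b \<in> A \<and> a - b \<in> S_units S}\<rparr>"

text \<open>An ordered finite subset is a list without repetitions; \<open>A' = u A + b\<close> is read entry by
  entry.\<close>

definition ordered_subset :: "rat list \<Rightarrow> nat set \<Rightarrow> bool" where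
  "ordered_subset A S \<longleftrightarrow> distinct A \<and> set A \<subseteq> S_integers S"

definition S_equivalent :: "nat set \<Rightarrow> rat list \<Rightarrow> rat list \<Rightarrow> bool" where
  "S_equivalent S A A' \<longleftrightarrow>
     (\<exists>u\<in>S_units S. \<exists>b\<in>S_integers S. A' = map (\<lambda>a. u * a + b) A)"

definition representable :: "nat set \<Rightarrow> 'v ugraph \<Rightarrow> bool" where
  "representable S G \<longleftrightarrow>
     (\<exists>A. finite A \<and> A \<subseteq> S_integers S \<and> graph_isomorphic G (S_unit_graph S A))"

text \<open>Different orderings of one set may be inequivalent, but a finite set has only finitely many
  orderings, so an infinite family of ordered subsets as below involves infinitely many underlying
  sets that are inequivalent under any choice of orderings.\<close>

definition infinitely_representable :: "nat set \<Rightarrow> 'v ugraph \<Rightarrow> bool" where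
  "infinitely_representable S G \<longleftrightarrow>
     (\<exists>\<A>. infinite \<A> \<and>
          (\<forall>A\<in>\<A>. ordered_subset A S \<and> graph_isomorphic G (S_unit_graph S (set A))) \<and>
          pairwise (\<lambda>A A'. \<not> S_equivalent S A A') \<A>)"

end

theory Submission
  imports Defs "HOL-Library.Countable" "HOL-Computational_Algebra.Polynomial"
begin

text \<open>
  The bound on \<open>p\<close> makes a representation over \<open>{p}\<close> purely combinatorial. After clearing
  denominators, the vertices are integers and two of them are adjacent exactly when they differ by
  some \<open>\<plusminus>p\<^sup>k\<close>. Within a connected component, a shortest walk from a fixed root \<open>r\<close> writes
  \<open>f v - f r\<close> as a sum of at most \<open>|E|\<close> signed powers of \<open>p\<close>, that is, as the value at \<open>p\<close> of an
  integer polynomial \<open>h v\<close> whose coefficients have absolute values adding up to at most \<open>|E|\<close>. Along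
  an edge \<open>{x, y}\<close> the polynomial \<open>h x - h y \<minusplus> X\<^sup>k\<close> vanishes at \<open>p\<close> and has coefficient norm at most
  \<open>2|E| + 1 \<le> p\<close>; such a polynomial is zero (\<open>poly_root_small_l1\<close>). So \<open>p\<close> may be replaced by an
  indeterminate: each component is an induced subgraph of the lattice of integer vectors in which
  neighbours differ by a unit vector (\<open>single_prime_lattice_coordinates\<close>).

  Encoding a coordinate \<open>c\<close> by the set of integers below \<open>c\<close>, truncated at a common lower bound,
  turns the lattice into a hypercube: \<open>G\<close> becomes a family of distinct finite sets \<open>D v\<close> in which
  adjacency means that the symmetric difference is a singleton
  (\<open>lattice_hypercube_embedding\<close>). Two private elements for each component keep different
  components apart.

  Hypercube families are representable over every \<open>S\<close>. Let \<open>M\<close> be the square of the product of the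
  primes in \<open>S\<close> and send \<open>v\<close> to the sum of the powers \<open>M\<^sup>i\<close> with \<open>i \<in> D v\<close>. A difference of two
  such values is a sum of signed powers of \<open>M\<close> over the symmetric difference. With one term it is an
  S-unit. With more terms, dividing by the least power of \<open>M\<close> leaves an integer that is \<open>\<plusminus>1\<close> modulo
  \<open>M\<close>, hence prime to \<open>S\<close>, and is different from \<open>\<plusminus>1\<close>, so it is not an S-unit
  (\<open>signed_power_sum_S_unit_iff\<close>).

  Relabelling the elements of the sets \<open>D v\<close> by other exponents gives infinitely many
  representations. Some element \<open>j\<close> separates one of three given vertices from the other two; if only
  the exponent of \<open>j\<close> varies, then the difference of those two vertices stays fixed while the
  distance to the third one changes, which no affine map \<open>a \<mapsto> u a + b\<close> can undo
  (\<open>hypercube_infinitely_representable\<close>).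
\<close>

section \<open>Integral S-units\<close>

lemma S_integers_fraction:
  assumes "n \<noteq> 0" and "\<And>q. prime q \<Longrightarrow> int q dvd n \<Longrightarrow> q \<in> S"
  shows "of_int m / of_int n \<in> S_integers S"
proof -
  obtain a b where ab: "quotient_of (of_int m / of_int n) = (a, b)"
    by (cases "quotient_of (of_int m / of_int n)")
  have b: "b > 0" "coprime a b"
    using quotient_of_denom_pos[OF ab] quotient_of_coprime[OF ab] by auto
  have "(of_int m / of_int n :: rat) = of_int a / of_int b"
    using quotient_of_div[OF ab] .
  hence "of_int (m * b) = (of_int (a * n) :: rat)"
    using b assms(1) by (simp add: field_simps)
  hence "m * b = a * n" by (simp only: of_int_eq_iff)
  hence "b dvd a * n" by (metis dvd_triv_right)
  hence "b dvd n" using b(2) by (simp add: coprime_dvd_mult_right_iff coprime_commute)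
  thus ?thesis using assms(2) by (auto simp: S_integers_def ab intro: dvd_trans)
qed

lemma S_integersE:
  assumes "x \<in> S_integers S"
  obtains m n where "x = of_int m / of_int n" "n > 0" "\<And>q. prime q \<Longrightarrow> int q dvd n \<Longrightarrow> q \<in> S"
proof -
  obtain a b where ab: "quotient_of x = (a, b)" by (cases "quotient_of x")
  show thesis
    using that[OF quotient_of_div[OF ab] quotient_of_denom_pos[OF ab]] assms
    by (auto simp: S_integers_def ab)
qed

lemma of_int_in_S_integers: "of_int z \<in> S_integers S"
proof -
  have "of_int z / of_int 1 \<in> S_integers S"
    by (rule S_integers_fraction) auto
  thus ?thesis by simp
qed

lemma S_integers_mult:
  assumes "x \<in> S_integers S" "y \<in> S_integers S"
  shows "x * y \<in> S_integers S"
proof -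
  obtain a b where x: "x = of_int a / of_int b" "b > 0" "\<And>q. prime q \<Longrightarrow> int q dvd b \<Longrightarrow> q \<in> S"
    using S_integersE[OF assms(1)] by metis
  obtain c d where y: "y = of_int c / of_int d" "d > 0" "\<And>q. prime q \<Longrightarrow> int q dvd d \<Longrightarrow> q \<in> S"
    using S_integersE[OF assms(2)] by metis
  have "of_int (a * c) / of_int (b * d) \<in> S_integers S"
  proof (rule S_integers_fraction)
    show "b * d \<noteq> 0" using x(2) y(2) by simp
    show "q \<in> S" if "prime q" "int q dvd b * d" for q
      using that x(3) y(3) by (auto simp: prime_dvd_mult_iff)
  qed
  thus ?thesis using x(1) y(1) by simp
qed

lemma S_units_mult:
  assumes "u \<in> S_units S" "v \<in> S_units S"
  shows "u * v \<in> S_units S"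
proof -
  obtain u' v' where "u' \<in> S_integers S" "u * u' = 1" "v' \<in> S_integers S" "v * v' = 1"
    using assms by (auto simp: S_units_def)
  moreover from this have "(u * v) * (u' * v') = 1"
    by (metis mult.assoc mult.left_commute mult_1_right)
  ultimately show ?thesis
    using assms by (auto simp: S_units_def intro: S_integers_mult)
qed

lemma S_units_mult_cancel:
  assumes "u \<in> S_units S"
  shows "u * x \<in> S_units S \<longleftrightarrow> x \<in> S_units S"
proof
  assume ux: "u * x \<in> S_units S"
  obtain v where v: "v \<in> S_integers S" "u * v = 1" using assms by (auto simp: S_units_def)
  hence "v \<in> S_units S"
    using assms by (auto simp: S_units_def mult.commute intro!: bexI[of _ u])
  from S_units_mult[OF this ux] show "x \<in> S_units S"
    using v(2) by (metis mult.assoc mult.commute mult_1_left)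
qed (rule S_units_mult[OF assms])

lemma of_int_in_S_units_iff:
  "of_int z \<in> S_units S \<longleftrightarrow> z \<noteq> 0 \<and> (\<forall>q. prime q \<and> int q dvd z \<longrightarrow> q \<in> S)"
proof (intro iffI conjI allI impI)
  assume u: "of_int z \<in> S_units S"
  then obtain v where v: "v \<in> S_integers S" "of_int z * v = 1" by (auto simp: S_units_def)
  show "z \<noteq> 0" using v(2) by auto
  fix q assume q: "prime q \<and> int q dvd z"
  obtain a b where v': "v = of_int a / of_int b" "b > 0"
      "\<And>q. prime q \<Longrightarrow> int q dvd b \<Longrightarrow> q \<in> S"
    using S_integersE[OF v(1)] by metis
  have "of_int (z * a) = (of_int b :: rat)" using v(2) v' by (simp add: field_simps)
  hence "z * a = b" by (simp only: of_int_eq_iff)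
  thus "q \<in> S" using q v'(3) by auto
next
  assume z: "z \<noteq> 0 \<and> (\<forall>q. prime q \<and> int q dvd z \<longrightarrow> q \<in> S)"
  have "of_int 1 / of_int z \<in> S_integers S" using z by (intro S_integers_fraction) auto
  thus "of_int z \<in> S_units S"
    using z by (auto simp: S_units_def of_int_in_S_integers intro!: bexI[of _ "1 / of_int z"])
qed

lemma uminus_in_S_units_iff: "- u \<in> S_units S \<longleftrightarrow> u \<in> S_units S"
proof -
  have "of_int (- 1) \<in> S_units S"
    unfolding of_int_in_S_units_iff by (auto simp: prime_dvd_mult_iff)
  from S_units_mult_cancel[OF this] show ?thesis by simp
qed

lemma S_unit_graph_edge_iff:
  assumes "a \<in> A" "b \<in> A"
  shows "{a, b} \<in> edges (S_unit_graph S A) \<longleftrightarrow> a - b \<in> S_units S"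
  using assms uminus_in_S_units_iff[of "a - b" S]
  by (auto simp: S_unit_graph_def doubleton_eq_iff)

lemma int_S_unit_singleton_iff:
  assumes "prime p"
  shows "of_int z \<in> S_units {p} \<longleftrightarrow> (\<exists>k. \<exists>s\<in>{1, -1}. z = s * int p ^ k)"
proof
  assume "of_int z \<in> S_units {p}"
  hence z: "z \<noteq> 0" "\<And>q. prime q \<Longrightarrow> int q dvd z \<Longrightarrow> q = p"
    unfolding of_int_in_S_units_iff by auto
  have "\<not> is_unit p" using assms by auto
  then obtain y where y: "nat \<bar>z\<bar> = p ^ multiplicity p (nat \<bar>z\<bar>) * y" "\<not> p dvd y"
    using multiplicity_decompose'[of "nat \<bar>z\<bar>" p] z(1) by auto
  have "y = 1"
  proof (rule ccontr)
    assume "y \<noteq> 1"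
    then obtain q where q: "prime q" "q dvd y" using prime_factor_nat by blast
    hence "q dvd nat \<bar>z\<bar>" using y(1) by (metis dvd_mult)
    hence "int q dvd z" by (simp add: int_dvd_int_iff[symmetric])
    thus False using q y(2) z(2) by blast
  qed
  with y(1) obtain k where "nat \<bar>z\<bar> = p ^ k" by auto
  hence "\<bar>z\<bar> = int p ^ k" by (metis abs_ge_zero nat_0_le of_nat_power)
  hence "z = 1 * int p ^ k \<or> z = - 1 * int p ^ k" by linarith
  thus "\<exists>k. \<exists>s\<in>{1, -1}. z = s * int p ^ k" by blast
next
  assume "\<exists>k. \<exists>s\<in>{1, -1}. z = s * int p ^ k"
  then obtain k s where ks: "s \<in> {1, -1}" "z = s * int p ^ k" by blast
  have "q = p" if "prime q" "int q dvd z" for q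
  proof -
    have "int q dvd int p ^ k" using that ks by auto
    hence "q dvd p" using that(1) by (metis int_dvd_int_iff of_nat_power prime_dvd_power)
    thus ?thesis using assms that(1) by (simp add: primes_dvd_imp_eq)
  qed
  moreover have "z \<noteq> 0" using ks assms by (auto simp: prime_gt_0_nat)
  ultimately show "of_int z \<in> S_units {p}" unfolding of_int_in_S_units_iff by blast
qed

definition integral_representation :: "nat set \<Rightarrow> 'v ugraph \<Rightarrow> ('v \<Rightarrow> int) \<Rightarrow> bool" where
  "integral_representation S G f \<longleftrightarrow> inj_on f (verts G) \<and>
     (\<forall>x\<in>verts G. \<forall>y\<in>verts G. {x, y} \<in> edges G \<longleftrightarrow> of_int (f x - f y) \<in> S_units S)"

lemma integral_representation_isomorphic:
  assumes "integral_representation S G f"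
  shows "graph_isomorphic G (S_unit_graph S (of_int ` f ` verts G))"
proof -
  let ?g = "\<lambda>x. of_int (f x) :: rat"
  have "bij_betw ?g (verts G) (of_int ` f ` verts G)"
    using assms by (auto simp: integral_representation_def bij_betw_def inj_on_def)
  moreover have "{x, y} \<in> edges G \<longleftrightarrow> {?g x, ?g y} \<in> edges (S_unit_graph S (of_int ` f ` verts G))"
    if "x \<in> verts G" "y \<in> verts G" for x y
    using assms that
    by (subst S_unit_graph_edge_iff) (auto simp: integral_representation_def)
  ultimately show ?thesis
    unfolding graph_isomorphic_def by (auto simp: S_unit_graph_def intro!: exI[of _ ?g])
qed

text \<open>
  The product of all denominators of the represented vertices is itself an S-unit, so multiplying by
  it changes no adjacency.
\<close>

lemma representable_integral:
  assumes "representable S G"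
  shows "\<exists>f. integral_representation S G f"
proof -
  obtain A where A: "finite A" "A \<subseteq> S_integers S" "graph_isomorphic G (S_unit_graph S A)"
    using assms by (auto simp: representable_def)
  obtain g where g: "bij_betw g (verts G) A"
      "\<And>x y. x \<in> verts G \<Longrightarrow> y \<in> verts G \<Longrightarrow>
        {x, y} \<in> edges G \<longleftrightarrow> {g x, g y} \<in> edges (S_unit_graph S A)"
    using A(3) by (auto simp: graph_isomorphic_def S_unit_graph_def)
  \<comment> \<open>Only primes of \<open>S\<close> divide these denominators.\<close>
  define den where "den = (\<Prod>a\<in>A. snd (quotient_of a))"
  have den_pos: "den > 0"
    unfolding den_def by (intro prod_pos) (metis quotient_of_denom_pos')
  have "q \<in> S" if q: "prime q" "int q dvd den" for q
  proof -
    obtain a where "a \<in> A" "int q dvd snd (quotient_of a)"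
      using q prime_dvd_prod_iff[OF A(1), of "int q"] by (auto simp: den_def)
    thus ?thesis using A(2) q(1) by (auto simp: S_integers_def)
  qed
  hence den_unit: "of_int den \<in> S_units S"
    using den_pos unfolding of_int_in_S_units_iff by auto
  have "\<exists>m. of_int den * a = of_int m" if "a \<in> A" for a
  proof -
    have "snd (quotient_of a) dvd den" unfolding den_def using A(1) that by (rule dvd_prodI)
    then obtain c where c: "den = snd (quotient_of a) * c" ..
    have "a = of_int (fst (quotient_of a)) / of_int (snd (quotient_of a))"
      by (metis quotient_of_div prod.collapse)
    moreover have "snd (quotient_of a) > 0" by (rule quotient_of_denom_pos')
    ultimately have "of_int den * a = of_int (c * fst (quotient_of a))"
      unfolding c by (simp add: field_simps)
    thus ?thesis ..
  qed
  then obtain m where m: "\<And>a. a \<in> A \<Longrightarrow> of_int den * a = of_int (m a)" by metis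
  have gA: "g x \<in> A" if "x \<in> verts G" for x using g(1) that by (auto simp: bij_betw_def)
  have "inj_on (\<lambda>x. m (g x)) (verts G)"
  proof (rule inj_onI)
    fix x y assume xy: "x \<in> verts G" "y \<in> verts G" "m (g x) = m (g y)"
    hence "of_int den * g x = of_int den * g y" using m gA by metis
    hence "g x = g y" using den_pos by simp
    thus "x = y" using g(1) xy by (auto simp: bij_betw_def inj_on_def)
  qed
  moreover have "{x, y} \<in> edges G \<longleftrightarrow> of_int (m (g x) - m (g y)) \<in> S_units S"
    if "x \<in> verts G" "y \<in> verts G" for x y
  proof -
    have "of_int (m (g x) - m (g y)) = of_int den * (g x - g y)"
      using m[OF gA[OF that(1)]] m[OF gA[OF that(2)]] by (simp add: right_diff_distrib)
    thus ?thesis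
      using g(2)[OF that] gA that by (simp add: S_unit_graph_edge_iff S_units_mult_cancel[OF den_unit])
  qed
  ultimately show ?thesis unfolding integral_representation_def by blast
qed

section \<open>Induced subgraphs of hypercubes\<close>

text \<open>
  A vertex of the hypercube is a finite set, and its neighbours arise by inserting or deleting one
  element; no bound on the dimension is fixed.
\<close>

definition hypercube_embedding :: "'v ugraph \<Rightarrow> ('v \<Rightarrow> 'i set) \<Rightarrow> bool" where
  "hypercube_embedding G D \<longleftrightarrow> inj_on D (verts G) \<and> (\<forall>x\<in>verts G. finite (D x)) \<and>
     (\<forall>x\<in>verts G. \<forall>y\<in>verts G. {x, y} \<in> edges G \<longleftrightarrow> (\<exists>i. sym_diff (D x) (D y) = {i}))"

lemma inj_image_singleton_iff:
  assumes "inj g"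
  shows "(\<exists>j. g ` A = {j}) \<longleftrightarrow> (\<exists>i. A = {i})"
proof
  assume "\<exists>j. g ` A = {j}"
  then obtain j where j: "g ` A = {j}" ..
  then obtain a where "a \<in> A" by blast
  moreover have "x = y" if "x \<in> A" "y \<in> A" for x y
    using that j assms by (metis imageI injD singletonD)
  ultimately have "A = {a}" by blast
  thus "\<exists>i. A = {i}" ..
qed auto

lemma hypercube_embedding_relabel:
  assumes "hypercube_embedding G D" "inj g"
  shows "hypercube_embedding G (\<lambda>x. g ` D x)"
proof -
  have sd: "sym_diff (g ` A) (g ` B) = g ` sym_diff A B" for A B
    using assms(2) by (auto simp: inj_def)
  show ?thesis
    using assms unfolding hypercube_embedding_def sd inj_image_singleton_iff[OF assms(2)]
    by (simp add: inj_on_def inj_image_eq_iff)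
qed

section \<open>Signed sums of distinct powers\<close>

text \<open>
  Only the smallest exponent contributes a term that is not divisible by the next power of \<open>M\<close>.
  The sum of the remaining terms is recorded with the same cofactor \<open>y\<close>, so that \<open>y \<noteq> 0\<close> can be read
  off from it.
\<close>

lemma signed_power_sum_factor:
  fixes c :: "nat \<Rightarrow> int" and M :: int
  assumes "finite T" "T \<noteq> {}"
  shows "\<exists>y. (\<Sum>i\<in>T. c i * M ^ i) = M ^ Min T * (c (Min T) + M * y) \<and>
    (\<Sum>i\<in>T - {Min T}. c i * M ^ i) = M ^ Suc (Min T) * y"
proof -
  let ?m = "Min T" and ?r = "\<Sum>i\<in>T - {Min T}. c i * M ^ i"
  have "M ^ Suc ?m dvd ?r"
  proof (rule dvd_sum)
    fix i assume i: "i \<in> T - {Min T}"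
    hence "Min T \<le> i" using assms(1) by simp
    hence "Suc ?m \<le> i" using i by (simp add: le_neq_implies_less Suc_leI)
    thus "M ^ Suc ?m dvd c i * M ^ i" by (intro dvd_mult le_imp_power_dvd)
  qed
  then obtain y where y: "?r = M ^ Suc ?m * y" ..
  have "(\<Sum>i\<in>T. c i * M ^ i) = c ?m * M ^ ?m + ?r"
    using sum.remove[OF assms(1) Min_in[OF assms]] by simp
  thus ?thesis using y by (intro exI[of _ y]) (simp add: algebra_simps)
qed

text \<open>
  After division by the smallest power, the sum is \<open>\<plusminus>1\<close> modulo \<open>M\<close>.
\<close>

lemma signed_power_sum_nonzero:
  fixes c :: "nat \<Rightarrow> int" and M :: int
  assumes "finite T" "T \<noteq> {}" "\<And>i. i \<in> T \<Longrightarrow> \<bar>c i\<bar> = 1" "M > 1"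
  shows "(\<Sum>i\<in>T. c i * M ^ i) \<noteq> 0"
proof
  assume z: "(\<Sum>i\<in>T. c i * M ^ i) = 0"
  obtain y where "(\<Sum>i\<in>T. c i * M ^ i) = M ^ Min T * (c (Min T) + M * y)"
    using signed_power_sum_factor[OF assms(1,2)] by blast
  with z assms(4) have "c (Min T) + M * y = 0" by simp
  hence "c (Min T) = M * (- y)" by simp
  hence "M dvd c (Min T)" by (rule dvdI)
  moreover have "\<bar>c (Min T)\<bar> = 1" using assms by simp
  ultimately have "M dvd 1" by (metis dvd_abs_iff)
  thus False using assms(4) by (simp add: zdvd_not_zless)
qed

text \<open>
  The product of the primes is squared because base \<open>2\<close> would be too small for
  \<open>S = {2}\<close>: the sum \<open>2 - 1\<close> of two signed powers is a unit. From base \<open>4\<close> on, a nonzero multiple of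
  the base added to \<open>\<plusminus>1\<close> never gives \<open>\<plusminus>1\<close>.
\<close>

lemma square_prod_primes_ge_4:
  assumes "finite S" "S \<noteq> {}" "\<forall>q\<in>S. prime q"
  shows "(int (\<Prod>S))\<^sup>2 \<ge> 4"
proof -
  obtain q where q: "q \<in> S" using assms(2) by blast
  have "\<Prod>S \<noteq> 0" using assms(1,3) by (auto dest: prime_gt_0_nat)
  moreover have "q dvd \<Prod>S" using dvd_prodI[OF assms(1) q, of "\<lambda>x. x"] .
  ultimately have "\<Prod>S \<ge> 2"
    using q assms(3) by (meson dvd_imp_le not_gr_zero order_trans prime_ge_2_nat)
  hence "2\<^sup>2 \<le> (\<Prod>S)\<^sup>2" by (rule power_mono) simp
  hence "int (2\<^sup>2) \<le> int ((\<Prod>S)\<^sup>2)" by (simp only: of_nat_le_iff)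
  thus ?thesis by (simp only: of_nat_power) simp
qed

text \<open>
  Up to a power of \<open>M\<close>, which is an S-unit, the sum is an integer \<open>\<plusminus>1 + M y\<close>. Every prime of \<open>S\<close>
  divides \<open>M\<close>, so none divides this integer; it is an S-unit only if it is \<open>\<plusminus>1\<close>. Since \<open>M \<ge> 4\<close>,
  that means \<open>y = 0\<close>, and then no further powers occur.
\<close>

lemma signed_power_sum_S_unit_iff:
  fixes c :: "nat \<Rightarrow> int"
  assumes "finite S" "S \<noteq> {}" "\<forall>q\<in>S. prime q"
    and "finite T" "T \<noteq> {}" and c: "\<And>i. i \<in> T \<Longrightarrow> \<bar>c i\<bar> = 1"
  defines "M \<equiv> (int (\<Prod>S))\<^sup>2"
  shows "of_int (\<Sum>i\<in>T. c i * M ^ i) \<in> S_units S \<longleftrightarrow> (\<exists>m. T = {m})"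
proof -
  define Q where "Q = \<Prod>S"
  have M_Q: "M = int Q * int Q" unfolding M_def Q_def power2_eq_square ..
  have dvd_Q: "q dvd Q" if "q \<in> S" for q
    unfolding Q_def using dvd_prodI[OF assms(1) that, of "\<lambda>x. x"] .
  have M: "M \<ge> 4" unfolding M_def using assms(1-3) by (rule square_prod_primes_ge_4)
  have prime_dvd_M: "int q dvd M" if "q \<in> S" for q
    using dvd_Q[OF that] unfolding M_Q by simp
  have M_units: "q \<in> S" if q: "prime q" "int q dvd M" for q
  proof -
    have "int q dvd int Q" using q unfolding M_Q by (simp add: prime_dvd_mult_iff)
    hence "q dvd Q" by simp
    then obtain r where "r \<in> S" "q dvd r" using q(1) prime_dvd_prod_iff[OF assms(1), of q id]
      unfolding Q_def by auto
    thus ?thesis using assms(3) q(1) primes_dvd_imp_eq by blast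
  qed
  let ?m = "Min T"
  have m: "?m \<in> T" using assms(4,5) by simp
  obtain y where y: "(\<Sum>i\<in>T. c i * M ^ i) = M ^ ?m * (c ?m + M * y)"
      "(\<Sum>i\<in>T - {?m}. c i * M ^ i) = M ^ Suc ?m * y"
    using signed_power_sum_factor[OF assms(4,5)] by blast
  have Mm: "M ^ ?m \<noteq> 0" using M by simp
  have factor: "of_int (\<Sum>i\<in>T. c i * M ^ i) \<in> S_units S \<longleftrightarrow> of_int (c ?m + M * y) \<in> S_units S"
  proof -
    have "q \<in> S" if q: "prime q" "int q dvd M ^ ?m" for q
    proof -
      have "prime (int q)" using q(1) by simp
      from prime_dvd_power[OF this q(2)] show ?thesis using M_units q(1) by blast
    qed
    hence "of_int (M ^ ?m) \<in> S_units S"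
      unfolding of_int_in_S_units_iff using Mm by blast
    from S_units_mult_cancel[OF this] show ?thesis unfolding y(1) of_int_mult by blast
  qed
  show ?thesis
  proof
    assume u: "of_int (\<Sum>i\<in>T. c i * M ^ i) \<in> S_units S"
    show "\<exists>m. T = {m}"
    proof (rule ccontr)
      assume "\<nexists>m. T = {m}"
      hence "T - {?m} \<noteq> {}" using m by auto
      hence "M ^ Suc ?m * y \<noteq> 0"
        unfolding y(2)[symmetric] using c M assms(4)
        by (intro signed_power_sum_nonzero) auto
      hence "y \<noteq> 0" by auto
      hence "\<bar>M * y\<bar> \<ge> 4 * 1" unfolding abs_mult using M by (intro mult_mono) auto
      moreover have c1: "\<bar>c ?m\<bar> = 1" using c m by blast
      ultimately have "\<bar>c ?m + M * y\<bar> > 1" by linarith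
      hence "nat \<bar>c ?m + M * y\<bar> \<noteq> 1" by linarith
      then obtain q where q: "prime q" "q dvd nat \<bar>c ?m + M * y\<bar>" using prime_factor_nat by blast
      hence dq: "int q dvd c ?m + M * y" by (simp add: int_dvd_int_iff[symmetric])
      moreover have "\<forall>q. prime q \<and> int q dvd c ?m + M * y \<longrightarrow> q \<in> S"
        using u of_int_in_S_units_iff[of "c ?m + M * y" S] factor by simp
      ultimately have "q \<in> S" using q(1) by simp
      hence "int q dvd M * y" using prime_dvd_M by simp
      hence "int q dvd c ?m" using dq by (metis dvd_add_left_iff)
      hence "int q dvd 1" using c1 by (metis dvd_abs_iff)
      thus False using q(1) by simp
    qed
  next
    assume "\<exists>m. T = {m}"
    hence "T - {?m} = {}" by force
    hence "M * y = 0" using y(2) M by (metis mult_eq_0_iff power_eq_0_iff sum.empty mult_zero_right)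
    moreover have "\<bar>c ?m\<bar> = 1" using c m by blast
    ultimately have "\<bar>c ?m + M * y\<bar> = 1" by (simp only: add_0_right)
    hence "c ?m + M * y = 1 \<or> c ?m + M * y = - 1" by linarith
    hence "of_int (c ?m + M * y) \<in> S_units S"
      by (subst of_int_in_S_units_iff) auto
    thus "of_int (\<Sum>i\<in>T. c i * M ^ i) \<in> S_units S" using factor by simp
  qed
qed

section \<open>Representing induced subgraphs of hypercubes\<close>

lemma hypercube_power_representation:
  fixes D :: "'v \<Rightarrow> nat set"
  assumes "finite S" "S \<noteq> {}" "\<forall>q\<in>S. prime q" and D: "hypercube_embedding G D"
  shows "integral_representation S G (\<lambda>v. \<Sum>i\<in>D v. ((int (\<Prod>S))\<^sup>2) ^ i)"
proof -
  define M where "M = (int (\<Prod>S))\<^sup>2"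
  define f where "f v = (\<Sum>i\<in>D v. M ^ i)" for v
  have diff: "f x - f y = (\<Sum>i\<in>sym_diff (D x) (D y). (if i \<in> D x then 1 else - 1) * M ^ i)"
    if "x \<in> verts G" "y \<in> verts G" for x y
  proof -
    have fin: "finite (D x)" "finite (D y)" using D that by (auto simp: hypercube_embedding_def)
    have "f x - f y = (\<Sum>i\<in>D x - D y. M ^ i) - (\<Sum>i\<in>D y - D x. M ^ i)"
      using sum.Int_Diff[OF fin(1), of "\<lambda>i. M ^ i" "D y"] sum.Int_Diff[OF fin(2), of "\<lambda>i. M ^ i" "D x"]
      unfolding f_def by (simp add: Int_commute)
    also have "\<dots> = (\<Sum>i\<in>D x - D y. (if i \<in> D x then 1 else - 1) * M ^ i) +
        (\<Sum>i\<in>D y - D x. (if i \<in> D x then 1 else - 1) * M ^ i)"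
      by (simp add: sum_negf[symmetric])
    also have "\<dots> = (\<Sum>i\<in>sym_diff (D x) (D y). (if i \<in> D x then 1 else - 1) * M ^ i)"
      using fin by (intro sum.union_disjoint[symmetric]) auto
    finally show ?thesis .
  qed
  have unit: "of_int (f x - f y) \<in> S_units S \<longleftrightarrow> (\<exists>i. sym_diff (D x) (D y) = {i})"
    and nonzero: "f x \<noteq> f y"
    if xy: "x \<in> verts G" "y \<in> verts G" "D x \<noteq> D y" for x y
  proof -
    have T: "finite (sym_diff (D x) (D y))" "sym_diff (D x) (D y) \<noteq> {}"
      using D xy by (auto simp: hypercube_embedding_def)
    show iff: "of_int (f x - f y) \<in> S_units S \<longleftrightarrow> (\<exists>i. sym_diff (D x) (D y) = {i})"
      unfolding diff[OF xy(1,2)] M_def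
      by (rule signed_power_sum_S_unit_iff[OF assms(1-3) T]) simp
    have "f x - f y \<noteq> 0"
      unfolding diff[OF xy(1,2)] M_def
      using square_prod_primes_ge_4[OF assms(1-3)]
      by (intro signed_power_sum_nonzero[OF T]) auto
    thus "f x \<noteq> f y" by simp
  qed
  have "inj_on f (verts G)"
    using D nonzero unfolding hypercube_embedding_def inj_on_def by metis
  moreover have "{x, y} \<in> edges G \<longleftrightarrow> of_int (f x - f y) \<in> S_units S"
    if "x \<in> verts G" "y \<in> verts G" for x y
  proof (cases "D x = D y")
    case True
    hence "f x - f y = 0" unfolding f_def by simp
    hence "of_int (f x - f y) \<notin> S_units S" by (metis of_int_in_S_units_iff)
    moreover have "{x, y} \<notin> edges G" using D that True by (auto simp: hypercube_embedding_def)
    ultimately show ?thesis by blast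
  next
    case False
    thus ?thesis using unit[OF that] D that by (simp add: hypercube_embedding_def)
  qed
  ultimately show ?thesis unfolding integral_representation_def f_def M_def by blast
qed

text \<open>
  Two of three distinct sets disagree about some element \<open>i\<close>, and the third set must side with one of
  them.
\<close>

lemma separating_coordinate:
  assumes "inj_on D V" "card V \<ge> 3"
  obtains x y z i where "x \<in> V" "y \<in> V" "z \<in> V" "x \<noteq> y"
    "i \<in> D x \<longleftrightarrow> i \<in> D y" "i \<in> D z \<longleftrightarrow> i \<notin> D x"
proof -
  obtain u v w where uvw: "u \<in> V" "v \<in> V" "w \<in> V" "u \<noteq> v" "u \<noteq> w" "v \<noteq> w"
  proof -
    obtain T where "T \<subseteq> V" "card T = 3" using obtain_subset_with_card_n[OF assms(2)] by metis
    thus thesis using that by (auto simp: card_3_iff)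
  qed
  hence "D v \<noteq> D w" using assms(1) by (auto simp: inj_on_def)
  then obtain i where i: "i \<in> D v \<longleftrightarrow> i \<notin> D w" by blast
  show thesis
  proof (cases "i \<in> D u \<longleftrightarrow> i \<in> D v")
    case True
    thus thesis using that[of u v w i] uvw i by blast
  next
    case False
    thus thesis using that[of u w v i] uvw i by blast
  qed
qed

text \<open>
  All elements but \<open>j\<close> receive even exponents that do not depend on \<open>t\<close>, whereas \<open>j\<close> receives the odd
  exponent \<open>2 * t + 1\<close>. The vertices \<open>x\<close> and \<open>y\<close> lie on the same side of \<open>j\<close>, so their difference is
  the same nonzero number for every \<open>t\<close>; this forces \<open>u = 1\<close> in an S-equivalence. The
  difference of \<open>x\<close> and \<open>z\<close> contains \<open>\<plusminus> M ^ (2 * t + 1)\<close> and otherwise does not depend on \<open>t\<close>, so equivalent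
  members of the family have the same \<open>t\<close>.
\<close>

lemma hypercube_infinitely_representable:
  fixes D :: "'v \<Rightarrow> nat set"
  assumes S: "finite S" "S \<noteq> {}" "\<forall>q\<in>S. prime q"
    and fin: "finite (verts G)" and card: "card (verts G) \<ge> 3"
    and D: "hypercube_embedding G D"
  shows "infinitely_representable S G"
proof -
  define M where "M = (int (\<Prod>S))\<^sup>2"
  have M: "M > 1" using square_prod_primes_ge_4[OF S] unfolding M_def by linarith
  obtain x y z j where xyz: "x \<in> verts G" "y \<in> verts G" "z \<in> verts G" "x \<noteq> y"
      and j: "j \<in> D x \<longleftrightarrow> j \<in> D y" "j \<in> D z \<longleftrightarrow> j \<notin> D x"
    using separating_coordinate[OF _ card, of D] D unfolding hypercube_embedding_def by metis
  define e :: "nat \<Rightarrow> nat \<Rightarrow> nat" where "e t i = (if i = j then 2 * t + 1 else 2 * i)" for t i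
  have e: "inj (e t)" for t
    unfolding e_def inj_def by (auto split: if_splits) presburger+
  define f where "f t v = (\<Sum>i\<in>e t ` D v. M ^ i)" for t v
  have f: "integral_representation S G (f t)" for t
    unfolding f_def[abs_def] M_def
    using hypercube_power_representation[OF S hypercube_embedding_relabel[OF D e]] .
  define g where "g v = (\<Sum>i\<in>D v - {j}. M ^ (2 * i))" for v
  have f_split: "f t v = g v + (if j \<in> D v then M ^ (2 * t + 1) else 0)" if "v \<in> verts G" for t v
  proof -
    have "f t v = (\<Sum>i\<in>D v. M ^ e t i)"
      unfolding f_def using e[of t] by (simp add: sum.reindex inj_on_def inj_def)
    also have "\<dots> = (\<Sum>i\<in>D v - {j}. M ^ e t i) + (if j \<in> D v then M ^ e t j else 0)"
      using D that by (auto simp: hypercube_embedding_def sum.remove)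
    also have "(\<Sum>i\<in>D v - {j}. M ^ e t i) = g v"
      unfolding g_def by (intro sum.cong) (auto simp: e_def)
    finally show ?thesis by (simp add: e_def)
  qed
  obtain vs where vs: "set vs = verts G" "distinct vs" using finite_distinct_list[OF fin] by blast
  define A where "A t = map (\<lambda>v. of_int (f t v) :: rat) vs" for t
  have rigid: "t = t'" if "S_equivalent S (A t) (A t')" for t t'
  proof -
    obtain u b where eq: "A t' = map (\<lambda>a. u * a + b) (A t)"
      using \<open>S_equivalent S (A t) (A t')\<close> by (auto simp: S_equivalent_def)
    have ub: "of_int (f t' v) = u * of_int (f t v) + b" if "v \<in> verts G" for v
      using eq that vs(1) by (auto simp: A_def)
    have "f t x \<noteq> f t y"
      using f[of t] xyz by (auto simp: integral_representation_def inj_on_def)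
    have same: "f s y - f s x = g y - g x" for s
      using j xyz by (simp add: f_split)
    have "of_int (f t' y - f t' x) = u * of_int (f t y - f t x)"
      using ub xyz by (simp add: algebra_simps)
    hence "u = 1" unfolding same[of t] same[of t'] using same[of t] \<open>f t x \<noteq> f t y\<close> by simp
    hence "of_int (f t' z - f t' x) = (of_int (f t z - f t x) :: rat)"
      using ub xyz by simp
    hence "f t' z - f t' x = f t z - f t x" by (simp only: of_int_eq_iff)
    hence "M ^ (2 * t' + 1) = M ^ (2 * t + 1)"
      using j xyz by (auto simp: f_split split: if_splits)
    thus "t = t'" using M by (simp del: power_Suc add: power_inject_exp)
  qed
  have refl: "S_equivalent S (A t) (A t)" for t
    using of_int_in_S_integers[of 0 S] of_int_in_S_units_iff[of 1 S]
    unfolding S_equivalent_def by (intro bexI[of _ 1] bexI[of _ 0]) simp_all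
  have "inj A" using rigid refl by (metis injI)
  hence "infinite (range A)" by (simp add: finite_image_iff)
  moreover have "pairwise (\<lambda>A A'. \<not> S_equivalent S A A') (range A)"
    using rigid by (auto simp: pairwise_def)
  moreover have "ordered_subset (A t) S \<and> graph_isomorphic G (S_unit_graph S (set (A t)))" for t
  proof
    have "distinct (A t)"
      using f[of t] vs by (auto simp: A_def distinct_map integral_representation_def inj_on_def)
    thus "ordered_subset (A t) S"
      by (auto simp: ordered_subset_def A_def of_int_in_S_integers)
    have "set (A t) = of_int ` f t ` verts G" using vs(1) by (auto simp: A_def)
    thus "graph_isomorphic G (S_unit_graph S (set (A t)))"
      using integral_representation_isomorphic[OF f[of t]] by simp
  qed
  ultimately show ?thesis
    unfolding infinitely_representable_def by (intro exI[of _ "range A"]) auto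
qed

section \<open>Sums of few signed powers\<close>

text \<open>
  The bound \<open>n\<close> on the sum of the absolute values of the coefficients is imposed on all partial sums,
  which avoids any reference to degrees.
\<close>

definition l1_le :: "int poly \<Rightarrow> int \<Rightarrow> bool" where
  "l1_le h n \<longleftrightarrow> (\<forall>N. (\<Sum>i\<le>N. \<bar>coeff h i\<bar>) \<le> n)"

lemma l1_le_diff:
  assumes "l1_le g m" "l1_le h n"
  shows "l1_le (g - h) (m + n)"
  unfolding l1_le_def
proof
  fix N
  have "(\<Sum>i\<le>N. \<bar>coeff (g - h) i\<bar>) \<le> (\<Sum>i\<le>N. \<bar>coeff g i\<bar> + \<bar>coeff h i\<bar>)"
    by (intro sum_mono) simp
  also have "\<dots> \<le> m + n"
    using assms by (simp add: l1_le_def sum.distrib add_mono)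
  finally show "(\<Sum>i\<le>N. \<bar>coeff (g - h) i\<bar>) \<le> m + n" .
qed

lemma l1_le_monom: "l1_le (monom s k) \<bar>s\<bar>"
proof -
  have "(\<Sum>i\<le>N. \<bar>coeff (monom s k) i\<bar>) = (\<Sum>i\<le>N. if k = i then \<bar>s\<bar> else 0)" for N
    by (intro sum.cong) auto
  thus ?thesis by (simp add: l1_le_def)
qed

lemma l1_le_coeff:
  assumes "l1_le h n"
  shows "\<bar>coeff h k\<bar> \<le> n"
proof -
  have "\<bar>coeff h k\<bar> \<le> (\<Sum>i\<le>k. \<bar>coeff h i\<bar>)"
    by (rule member_le_sum) auto
  also have "\<dots> \<le> n" using assms by (simp add: l1_le_def)
  finally show ?thesis .
qed

lemma l1_le_mono: "l1_le h m \<Longrightarrow> m \<le> n \<Longrightarrow> l1_le h n"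
  unfolding l1_le_def by (meson order_trans)

text \<open>
  This is the uniqueness of short expansions in base \<open>b\<close>. The constant coefficient is divisible by
  \<open>b\<close>. If it is zero, the argument passes to the quotient by the indeterminate; otherwise it uses up
  the whole norm, so the polynomial is a nonzero constant and has no root.
\<close>

lemma poly_root_small_l1:
  assumes "l1_le h b" "poly h b = 0" "b > 0"
  shows "h = 0"
  using assms
proof (induction h)
  case (pCons a g)
  have norm: "\<bar>a\<bar> + (\<Sum>i\<le>N. \<bar>coeff g i\<bar>) \<le> b" for N
  proof -
    have "(\<Sum>i\<le>Suc N. \<bar>coeff (pCons a g) i\<bar>) = \<bar>a\<bar> + (\<Sum>i\<le>N. \<bar>coeff g i\<bar>)"
      by (subst sum.atMost_Suc_shift) simp
    thus ?thesis using pCons.prems(1) by (metis l1_le_def)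
  qed
  have a: "a = - b * poly g b" using pCons.prems(2) by simp
  show ?case
  proof (cases "a = 0")
    case True
    have "l1_le g b" using norm True by (simp add: l1_le_def)
    moreover have "poly g b = 0" using a True pCons.prems(3) by simp
    ultimately have "g = 0" using pCons.IH pCons.prems(3) by blast
    thus ?thesis using True by simp
  next
    case False
    have "b dvd \<bar>a\<bar>" using a by simp
    hence "b \<le> \<bar>a\<bar>" using False by (intro zdvd_imp_le) auto
    hence "(\<Sum>i\<le>N. \<bar>coeff g i\<bar>) \<le> 0" for N using norm[of N] by linarith
    hence "l1_le g 0" by (simp add: l1_le_def)
    hence "coeff g k = 0" for k using l1_le_coeff[of g 0 k] by simp
    hence "g = 0" by (simp add: poly_eq_iff)
    hence "a = 0" using a by simp
    with False show ?thesis by simp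
  qed
qed simp

section \<open>From a single prime to lattice coordinates\<close>

definition edge_rel :: "'v ugraph \<Rightarrow> ('v \<times> 'v) set" where
  "edge_rel G = {(x, y). x \<in> verts G \<and> y \<in> verts G \<and> {x, y} \<in> edges G}"

lemma finite_edges: "finite_simple_graph G \<Longrightarrow> finite (edges G)"
  unfolding finite_simple_graph_def by (meson PowI finite_Pow_iff finite_subset subsetI)

text \<open>
  A shortest walk repeats no vertex, hence no edge. Counting undirected edges, rather than the pairs
  of the relation, keeps the bound at \<open>|E|\<close> instead of \<open>2|E|\<close>.
\<close>

lemma short_walk:
  assumes "finite (edges G)" and "(r, v) \<in> (edge_rel G)\<^sup>*"
  shows "\<exists>n \<le> card (edges G). (r, v) \<in> edge_rel G ^^ n"
proof -
  let ?R = "edge_rel G"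
  have ex: "\<exists>n. (r, v) \<in> ?R ^^ n" using assms(2) rtrancl_power by blast
  define n where "n = (LEAST n. (r, v) \<in> ?R ^^ n)"
  have n: "(r, v) \<in> ?R ^^ n" unfolding n_def using ex by (rule LeastI_ex)
  have least: "n \<le> m" if "(r, v) \<in> ?R ^^ m" for m unfolding n_def using that by (rule Least_le)
  obtain g where g: "g 0 = r" "g n = v" "\<And>i. i < n \<Longrightarrow> (g i, g (Suc i)) \<in> ?R"
    using n unfolding relpow_fun_conv by blast
  have seg: "(g i, g j) \<in> ?R ^^ (j - i)" if "i \<le> j" "j \<le> n" for i j
    unfolding relpow_fun_conv using that g(3) by (intro exI[of _ "\<lambda>k. g (i + k)"]) auto
  \<comment> \<open>A repeated vertex would allow a shortcut, against the minimality of \<open>n\<close>.\<close>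
  have inj: "i = j" if "i < j" "j \<le> n" "g i = g j" for i j
  proof -
    have "(r, g i) \<in> ?R ^^ i" using seg[of 0 i] that g(1) by simp
    moreover have "(g i, v) \<in> ?R ^^ (n - j)" using seg[of j n] that g(2) by simp
    ultimately have "(r, v) \<in> ?R ^^ (i + (n - j))" by (auto simp: relpow_add)
    from least[OF this] that show ?thesis by simp
  qed
  hence inj: "i = j" if "i \<le> n" "j \<le> n" "g i = g j" for i j
    using that by (metis linorder_neqE_nat)
  have "inj_on (\<lambda>i. {g i, g (Suc i)}) {..<n}"
  proof (rule inj_onI)
    fix i j assume ij: "i \<in> {..<n}" "j \<in> {..<n}" "{g i, g (Suc i)} = {g j, g (Suc j)}"
    hence "g i = g j \<or> g i = g (Suc j) \<and> g (Suc i) = g j" by (auto simp: doubleton_eq_iff)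
    \<comment> \<open>An edge traversed twice in opposite directions would give the impossible second case.\<close>
    hence "i = j \<or> i = Suc j \<and> Suc i = j"
      using ij(1,2) inj[of i j] inj[of i "Suc j"] inj[of "Suc i" j] by auto
    thus "i = j" by linarith
  qed
  moreover have "(\<lambda>i. {g i, g (Suc i)}) ` {..<n} \<subseteq> edges G"
    using g(3) by (auto simp: edge_rel_def)
  ultimately have "n \<le> card (edges G)"
    using card_inj_on_le[OF _ _ assms(1)] by fastforce
  with n show ?thesis by blast
qed

text \<open>
  Each step of the walk contributes one signed monomial; the polynomial remembers which powers of
  \<open>b\<close> were used.
\<close>

lemma walk_polynomial:
  fixes f :: "'v \<Rightarrow> int"
  assumes step: "\<And>x y. (x, y) \<in> R \<Longrightarrow> \<exists>k. \<exists>s\<in>{1, -1}. f x - f y = s * b ^ k"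
    and "(x, y) \<in> R ^^ n"
  shows "\<exists>h. l1_le h (int n) \<and> poly h b = f y - f x"
  using assms(2)
proof (induction n arbitrary: y)
  case 0
  thus ?case by (auto simp: l1_le_def intro!: exI[of _ 0])
next
  case (Suc n)
  then obtain z where z: "(x, z) \<in> R ^^ n" "(z, y) \<in> R" by auto
  obtain h where h: "l1_le h (int n)" "poly h b = f z - f x" using Suc.IH[OF z(1)] by blast
  obtain k s where ks: "s \<in> {1, -1}" "f z - f y = s * b ^ k" using step[OF z(2)] by blast
  have "l1_le (monom s k) 1" using l1_le_monom[of s k] ks(1) by auto
  hence "l1_le (h - monom s k) (int (Suc n))" using l1_le_diff[OF h(1)] by (metis int_Suc)
  moreover have "poly (h - monom s k) b = f y - f x" using h(2) ks(2) by (simp add: poly_monom)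
  ultimately show ?case by blast
qed

text \<open>
  The label \<open>c v\<close> is the integer at the root of the component of \<open>v\<close>, and \<open>h v\<close> comes from a shortest
  walk from that root to \<open>v\<close>, so that \<open>f v = c v + poly (h v) p\<close>. Any choice of shortest walks does: for an
  edge, \<open>h x - h y\<close> and the signed monomial of the edge have the same value at \<open>p\<close> and together norm
  at most \<open>2|E| + 1 \<le> p\<close>, hence they agree. Conversely, equal labels together with a signed monomial as
  difference make \<open>f x - f y\<close> a signed power of \<open>p\<close>.
\<close>

lemma single_prime_lattice_coordinates:
  fixes f :: "'v \<Rightarrow> int"
  assumes G: "finite_simple_graph G" and p: "prime p" "p > 2 * card (edges G)"
    and f: "integral_representation {p} G f"
  obtains c :: "'v \<Rightarrow> int" and h :: "'v \<Rightarrow> int poly" where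
    "inj_on (\<lambda>v. (c v, h v)) (verts G)"
    "\<And>x y. x \<in> verts G \<Longrightarrow> y \<in> verts G \<Longrightarrow>
      {x, y} \<in> edges G \<longleftrightarrow> c x = c y \<and> (\<exists>k. \<exists>s\<in>{1, -1}. h x - h y = monom s k)"
proof -
  let ?V = "verts G" and ?R = "edge_rel G" and ?m = "card (edges G)" and ?p = "int p"
  have edge: "{x, y} \<in> edges G \<longleftrightarrow> (\<exists>k. \<exists>s\<in>{1, -1}. f x - f y = s * ?p ^ k)"
    if "x \<in> ?V" "y \<in> ?V" for x y
    using f that unfolding integral_representation_def int_S_unit_singleton_iff[OF p(1)] by blast
  \<comment> \<open>Choosing from the set of reachable vertices gives the same root to connected vertices,
    because their reachability sets coincide.\<close>
  define root where "root v = (SOME w. (v, w) \<in> ?R\<^sup>*)" for v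
  have sym: "sym ?R" by (auto simp: edge_rel_def sym_def insert_commute)
  have root: "(root v, v) \<in> ?R\<^sup>*" for v
  proof -
    have "(v, root v) \<in> ?R\<^sup>*" unfolding root_def by (rule someI[of _ v]) simp
    thus ?thesis using sym by (metis sym_rtrancl symD)
  qed
  have root_edge: "root x = root y" if "(x, y) \<in> ?R" for x y
  proof -
    have "(x, w) \<in> ?R\<^sup>* \<longleftrightarrow> (y, w) \<in> ?R\<^sup>*" for w
      using that sym by (meson converse_rtrancl_into_rtrancl symD)
    thus ?thesis unfolding root_def by simp
  qed
  have step: "\<exists>k. \<exists>s\<in>{1, -1}. f x - f y = s * ?p ^ k" if "(x, y) \<in> ?R" for x y
    using that edge by (auto simp: edge_rel_def)
  have "\<exists>h. l1_le h (int ?m) \<and> poly h ?p = f v - f (root v)" for v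
  proof -
    obtain n where n: "n \<le> ?m" "(root v, v) \<in> ?R ^^ n"
      using short_walk[OF finite_edges[OF G] root] by blast
    obtain g where "l1_le g (int n)" "poly g ?p = f v - f (root v)"
      using walk_polynomial[where f = f and b = ?p, OF step n(2)] by blast
    moreover have "int n \<le> int ?m" using n(1) by simp
    ultimately show ?thesis using l1_le_mono by blast
  qed
  then obtain h where h: "\<And>v. l1_le (h v) (int ?m)" "\<And>v. poly (h v) ?p = f v - f (root v)"
    by metis
  show thesis
  proof (rule that[of "\<lambda>v. f (root v)" h])
    show "inj_on (\<lambda>v. (f (root v), h v)) ?V"
    proof (rule inj_onI)
      fix x y assume xy: "x \<in> ?V" "y \<in> ?V" "(f (root x), h x) = (f (root y), h y)"
      hence "f x = f y" using h(2)[of x] h(2)[of y] by simp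
      thus "x = y" using f xy by (auto simp: integral_representation_def inj_on_def)
    qed
  next
    fix x y assume xy: "x \<in> ?V" "y \<in> ?V"
    show "{x, y} \<in> edges G \<longleftrightarrow>
      f (root x) = f (root y) \<and> (\<exists>k. \<exists>s\<in>{1, -1}. h x - h y = monom s k)"
    proof
      assume E: "{x, y} \<in> edges G"
      have same: "root x = root y" using E xy by (intro root_edge) (simp add: edge_rel_def)
      obtain k s where ks: "s \<in> {1, -1}" "f x - f y = s * ?p ^ k"
        using E edge[OF xy] by blast
      have "l1_le (h x - h y - monom s k) (int ?m + int ?m + \<bar>s\<bar>)"
        by (intro l1_le_diff l1_le_monom h)
      moreover have "int ?m + int ?m + \<bar>s\<bar> \<le> ?p" using p(2) ks(1) by auto
      ultimately have "l1_le (h x - h y - monom s k) ?p" by (rule l1_le_mono)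
      moreover have "poly (h x - h y - monom s k) ?p = 0"
        using h(2)[of x] h(2)[of y] same ks(2) by (simp add: poly_monom)
      moreover have "?p > 0" using p(1) by (simp add: prime_gt_0_nat)
      ultimately have "h x - h y - monom s k = 0" by (rule poly_root_small_l1)
      hence "h x - h y = monom s k" by simp
      thus "f (root x) = f (root y) \<and> (\<exists>k. \<exists>s\<in>{1, -1}. h x - h y = monom s k)"
        using same ks(1) by auto
    next
      assume "f (root x) = f (root y) \<and> (\<exists>k. \<exists>s\<in>{1, -1}. h x - h y = monom s k)"
      then obtain k s where ks: "f (root x) = f (root y)" "s \<in> {1, -1}" "h x - h y = monom s k"
        by blast
      have "f x - f y = poly (h x - h y) ?p" using h(2)[of x] h(2)[of y] ks(1) by simp
      also have "\<dots> = s * ?p ^ k" using ks(3) by (simp add: poly_monom)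
      finally show "{x, y} \<in> edges G" using edge[OF xy] ks(2) by blast
    qed
  qed
qed

section \<open>From the lattice to the hypercube\<close>

lemma unit_gap_iff:
  fixes a b :: int
  shows "\<bar>a - b\<bar> = 1 \<longleftrightarrow> (\<exists>i. \<forall>j. (a \<le> j \<and> j < b \<or> b \<le> j \<and> j < a) \<longleftrightarrow> j = i)"
    (is "_ \<longleftrightarrow> (\<exists>i. \<forall>j. ?P j \<longleftrightarrow> j = i)")
proof
  assume "\<bar>a - b\<bar> = 1"
  thus "\<exists>i. \<forall>j. ?P j \<longleftrightarrow> j = i" by (intro exI[of _ "min a b"]) auto
next
  assume "\<exists>i. \<forall>j. ?P j \<longleftrightarrow> j = i"
  then obtain i where i: "\<And>j. ?P j \<longleftrightarrow> j = i" by blast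
  have "a \<noteq> b" using i[of i] by auto
  hence "min a b = i" "max a b - 1 = i" using i[of "min a b"] i[of "max a b - 1"] by auto
  thus "\<bar>a - b\<bar> = 1" by linarith
qed

text \<open>
  In each coordinate \<open>k\<close> the symmetric difference is the interval between \<open>a k\<close> and \<open>b k\<close>, so its size
  is the taxicab distance of the two lattice points.
\<close>

lemma staircase_sym_diff_singleton_iff:
  fixes a b :: "nat \<Rightarrow> int"
  assumes "\<And>k. k \<ge> K \<Longrightarrow> a k = b k" "\<And>k. - C \<le> a k" "\<And>k. - C \<le> b k"
  defines "stairs \<equiv> \<lambda>c. {(k, i). k < K \<and> - C \<le> i \<and> i < c k}"
  shows "(\<exists>e. sym_diff (stairs a) (stairs b) = {e}) \<longleftrightarrow>
    (\<exists>k. \<bar>a k - b k\<bar> = 1 \<and> (\<forall>l. l \<noteq> k \<longrightarrow> a l = b l))"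
proof -
  define P where "P k i \<longleftrightarrow> a k \<le> i \<and> i < b k \<or> b k \<le> i \<and> i < a k" for k i
  have mem: "(k, i) \<in> sym_diff (stairs a) (stairs b) \<longleftrightarrow> P k i" for k i
    using assms(1)[of k] assms(2,3)[of k] unfolding stairs_def P_def
    by (cases "k < K") auto
  have "(\<exists>e. sym_diff (stairs a) (stairs b) = {e}) \<longleftrightarrow> (\<exists>k i. \<forall>l j. P l j \<longleftrightarrow> l = k \<and> j = i)"
    unfolding set_eq_iff split_paired_Ex split_paired_All mem by simp
  also have "\<dots> \<longleftrightarrow> (\<exists>k. (\<exists>i. \<forall>j. P k j \<longleftrightarrow> j = i) \<and> (\<forall>l. l \<noteq> k \<longrightarrow> (\<forall>j. \<not> P l j)))"
    by metis
  also have "\<dots> \<longleftrightarrow> (\<exists>k. \<bar>a k - b k\<bar> = 1 \<and> (\<forall>l. l \<noteq> k \<longrightarrow> a l = b l))"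
  proof -
    have "(\<forall>j. \<not> P l j) \<longleftrightarrow> a l = b l" for l
      unfolding P_def by (metis linorder_less_linear order_refl not_less)
    thus ?thesis unfolding unit_gap_iff P_def by simp
  qed
  finally show ?thesis .
qed

lemma diff_signed_monom_iff:
  fixes g h :: "int poly"
  shows "(\<exists>k. \<bar>coeff g k - coeff h k\<bar> = 1 \<and> (\<forall>l. l \<noteq> k \<longrightarrow> coeff g l = coeff h l)) \<longleftrightarrow>
    (\<exists>k. \<exists>s\<in>{1, -1}. g - h = monom s k)" (is "?unit \<longleftrightarrow> ?monom")
proof
  assume ?unit
  then obtain k where k: "\<bar>coeff g k - coeff h k\<bar> = 1"
      "\<And>l. l \<noteq> k \<Longrightarrow> coeff g l = coeff h l" by blast
  have "g - h = monom (coeff g k - coeff h k) k"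
    using k(2) by (auto simp: poly_eq_iff)
  moreover have "coeff g k - coeff h k \<in> {1, -1}" using k(1) by auto
  ultimately show ?monom by blast
next
  assume ?monom
  then obtain k s where ks: "s \<in> {1, -1}" "g - h = monom s k" by blast
  have "coeff g l - coeff h l = (if k = l then s else 0)" for l
    using ks(2) by (metis coeff_diff coeff_monom)
  hence "coeff g k - coeff h k = s" "\<And>l. l \<noteq> k \<Longrightarrow> coeff g l - coeff h l = 0" by simp_all
  thus ?unit using ks(1) by (intro exI[of _ k]) auto
qed

text \<open>
  The lower bound \<open>- C\<close> and the number \<open>K\<close> of coordinates cut the staircases down to finite sets. The
  label contributes the two elements \<open>(c v, True)\<close> and \<open>(c v, False)\<close>: vertices with different labels
  then differ in at least four elements, so they are never adjacent.
\<close>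

lemma lattice_hypercube_embedding:
  fixes c :: "'v \<Rightarrow> 'c" and h :: "'v \<Rightarrow> int poly"
  assumes fin: "finite (verts G)"
    and inj: "inj_on (\<lambda>v. (c v, h v)) (verts G)"
    and edge: "\<And>x y. x \<in> verts G \<Longrightarrow> y \<in> verts G \<Longrightarrow>
      {x, y} \<in> edges G \<longleftrightarrow> c x = c y \<and> (\<exists>k. \<exists>s\<in>{1, -1}. h x - h y = monom s k)"
  shows "\<exists>D :: 'v \<Rightarrow> ((nat \<times> int) + ('c \<times> bool)) set. hypercube_embedding G D"
proof -
  let ?V = "verts G"
  define K where "K = Suc (Max ((\<lambda>v. degree (h v)) ` ?V))"
  have K: "coeff (h v) k = 0" if "v \<in> ?V" "k \<ge> K" for v k
  proof -
    have "degree (h v) \<le> Max ((\<lambda>v. degree (h v)) ` ?V)" using fin that(1) by simp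
    thus ?thesis using that(2) by (intro coeff_eq_0) (simp add: K_def)
  qed
  define C where "C = (\<Sum>v\<in>?V. \<Sum>k<K. \<bar>coeff (h v) k\<bar>)"
  have C: "\<bar>coeff (h v) k\<bar> \<le> C" if "v \<in> ?V" for v k
  proof (cases "k < K")
    case True
    hence "\<bar>coeff (h v) k\<bar> \<le> (\<Sum>k<K. \<bar>coeff (h v) k\<bar>)" by (intro member_le_sum) auto
    also have "\<dots> \<le> C"
      unfolding C_def using fin that
      by (intro member_le_sum[where f = "\<lambda>v. \<Sum>k<K. \<bar>coeff (h v) k\<bar>"]) (auto intro: sum_nonneg)
    finally show ?thesis .
  next
    case False
    have "C \<ge> 0" unfolding C_def by (intro sum_nonneg) auto
    thus ?thesis using K[OF that] False by simp
  qed
  have lower: "- C \<le> coeff (h v) k" and upper: "coeff (h v) k \<le> C" if "v \<in> ?V" for v k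
    using C[OF that, of k] by linarith+
  define stairs where "stairs v = {(k, i). k < K \<and> - C \<le> i \<and> i < coeff (h v) k}" for v
  define D :: "'v \<Rightarrow> ((nat \<times> int) + ('c \<times> bool)) set"
    where "D v = stairs v <+> ({c v} \<times> UNIV)" for v
  have "finite (D v)" if "v \<in> ?V" for v
  proof -
    have "stairs v \<subseteq> {..<K} \<times> {- C..C}"
    proof
      fix e assume "e \<in> stairs v"
      thus "e \<in> {..<K} \<times> {- C..C}" using upper[OF that, of "fst e"] by (auto simp: stairs_def)
    qed
    hence "finite (stairs v)" by (rule finite_subset) simp
    thus ?thesis unfolding D_def by simp
  qed
  moreover have "inj_on D ?V"
  proof (rule inj_onI)
    fix x y assume xy: "x \<in> ?V" "y \<in> ?V" "D x = D y"
    have "Inr (c x, True) \<in> D x" by (auto simp: D_def)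
    hence c: "c x = c y" unfolding xy(3) by (auto simp: D_def)
    have mem: "e \<in> stairs v \<longleftrightarrow> Inl e \<in> D v" for e v by (auto simp: D_def)
    have stairs: "e \<in> stairs x \<longleftrightarrow> e \<in> stairs y" for e unfolding mem xy(3) ..
    have "coeff (h x) k = coeff (h y) k" for k
    proof (cases "k < K")
      case True
      hence *: "i < coeff (h x) k \<longleftrightarrow> i < coeff (h y) k" if "- C \<le> i" for i
        using stairs[of "(k, i)"] that by (simp add: stairs_def)
      show ?thesis
        using *[OF lower[OF xy(1)], of k] *[OF lower[OF xy(2)], of k] by linarith
    qed (use K xy in auto)
    hence "h x = h y" by (simp add: poly_eq_iff)
    thus "x = y" using inj c xy by (auto simp: inj_on_def)
  qed
  moreover have "{x, y} \<in> edges G \<longleftrightarrow> (\<exists>i. sym_diff (D x) (D y) = {i})"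
    if xy: "x \<in> ?V" "y \<in> ?V" for x y
  proof (cases "c x = c y")
    case True
    have sd: "sym_diff (D x) (D y) = Inl ` sym_diff (stairs x) (stairs y)"
      unfolding D_def True by auto
    have "(\<exists>i. sym_diff (D x) (D y) = {i}) \<longleftrightarrow> (\<exists>i. sym_diff (stairs x) (stairs y) = {i})"
      unfolding sd by (rule inj_image_singleton_iff) simp
    also have "\<dots> \<longleftrightarrow> (\<exists>k. \<bar>coeff (h x) k - coeff (h y) k\<bar> = 1 \<and>
        (\<forall>l. l \<noteq> k \<longrightarrow> coeff (h x) l = coeff (h y) l))"
      unfolding stairs_def
      by (rule staircase_sym_diff_singleton_iff) (use K lower xy in auto)
    also have "\<dots> \<longleftrightarrow> {x, y} \<in> edges G"
      unfolding diff_signed_monom_iff edge[OF xy] by (simp only: True simp_thms)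
    finally show ?thesis by (rule sym)
  next
    case False
    hence two: "{Inr (c x, True), Inr (c x, False)} \<subseteq> sym_diff (D x) (D y)"
      unfolding D_def by auto
    have "sym_diff (D x) (D y) \<noteq> {i}" for i
    proof
      assume "sym_diff (D x) (D y) = {i}"
      from two[unfolded this] show False by auto
    qed
    thus ?thesis using edge[OF xy] False by blast
  qed
  ultimately show ?thesis unfolding hypercube_embedding_def by blast
qed

section \<open>Representability over every set of primes\<close>

theorem theorem4p1:
  fixes G :: "'v ugraph" and S :: "nat set"
  assumes "finite_simple_graph G"
    and "card (verts G) \<ge> 3"
    and "\<exists>p::nat. prime p \<and> p > 2 * card (edges G) \<and> representable {p} G"
    and "finite S" and "S \<noteq> {}" and "\<forall>q\<in>S. prime q"
  shows "infinitely_representable S G"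
proof -
  obtain p where p: "prime p" "p > 2 * card (edges G)" "representable {p} G"
    using assms(3) by blast
  obtain f where f: "integral_representation {p} G f" using representable_integral[OF p(3)] ..
  obtain c :: "'v \<Rightarrow> int" and h :: "'v \<Rightarrow> int poly" where
    ch: "inj_on (\<lambda>v. (c v, h v)) (verts G)"
      "\<And>x y. x \<in> verts G \<Longrightarrow> y \<in> verts G \<Longrightarrow>
        {x, y} \<in> edges G \<longleftrightarrow> c x = c y \<and> (\<exists>k. \<exists>s\<in>{1, -1}. h x - h y = monom s k)"
    by (rule single_prime_lattice_coordinates[OF assms(1) p(1,2) f]) blast
  have fin: "finite (verts G)" using assms(1) by (simp add: finite_simple_graph_def)
  obtain D :: "'v \<Rightarrow> ((nat \<times> int) + (int \<times> bool)) set" where "hypercube_embedding G D"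
    using lattice_hypercube_embedding[OF fin ch] by blast
  hence "hypercube_embedding G (\<lambda>v. to_nat ` D v)"
    by (rule hypercube_embedding_relabel) simp
  thus ?thesis
    by (rule hypercube_infinitely_representable[OF assms(4-6) fin assms(2)])
qed

end
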